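(* For any $\boldsymbol c\in(0,\infty)^N$, the Jacobian matrix $\boldsymbol W'(\boldsymbol c)$ is diagonalizable, with real, strictly positive, pairwise distinct eigenvalues $\lambda_1,\dots,\lambda_N$ satisfying $$1<\lambda_1<d_1<\lambda_2<\dots<d_{N-1}<\lambda_N<d_N,\qquad d_i=1+\eta_i\Big(1+\sum_{j=1}^N b_jc_j\Big)^{-1},\quad i=1,\dots,N.$$
   Context: Let $N\ge 1$ be an integer, $\epsilon\in(0,1)$, and let $a_i>0$, $b_i>0$ ($i=1,\dots,N$) be real constants with $0<a_1<a_2<\dots<a_N$. Put $\eta_i=\frac{1-\epsilon}{\epsilon}a_i$ for $i=1,\dots,N$. Let $\mathbb R_+^N=[0,\infty)^N$. The function $\boldsymbol W=(W_1,\dots,W_N)$ is defined on (a neighborhood of) $\mathbb R_+^N$ by $$W_i(\boldsymbol c)=c_i\left(1+\frac{\eta_i}{1+\sum_{j=1}^N b_jc_j}\right),\qquad 1\le i\le N,$$ and $\boldsymbol W'(\boldsymbol c)=\big(\partial W_i/\partial c_j(\boldsymbol c)\big)_{i,j=1}^N$ is its Jacobian matrix. *)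

theory Defs
  imports "HOL-Analysis.Derivative" "Jordan_Normal_Form.Char_Poly"
begin

text \<open>Points of \<open>\<real>\<^sup>N\<close> are functions \<open>nat \<Rightarrow> real\<close> of which only the
  components \<open>1, \<dots>, N\<close> are used.\<close>

definition eta :: "real \<Rightarrow> (nat \<Rightarrow> real) \<Rightarrow> nat \<Rightarrow> real" where
  "eta \<epsilon> a i = (1 - \<epsilon>) / \<epsilon> * a i"

definition W :: "nat \<Rightarrow> real \<Rightarrow> (nat \<Rightarrow> real) \<Rightarrow> (nat \<Rightarrow> real) \<Rightarrow> (nat \<Rightarrow> real) \<Rightarrow> nat \<Rightarrow> real" where
  "W N \<epsilon> a b c i = c i * (1 + eta \<epsilon> a i / (1 + (\<Sum>j=1..N. b j * c j)))"

definition partial_deriv :: "((nat \<Rightarrow> real) \<Rightarrow> real) \<Rightarrow> nat \<Rightarrow> (nat \<Rightarrow> real) \<Rightarrow> real" where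
  "partial_deriv f j c = deriv (\<lambda>t. f (c(j := t))) (c j)"

text \<open>Matrix indices start at 0, hence the shift by one.\<close>

definition jacobian_mat :: "nat \<Rightarrow> ((nat \<Rightarrow> real) \<Rightarrow> nat \<Rightarrow> real) \<Rightarrow> (nat \<Rightarrow> real) \<Rightarrow> real mat" where
  "jacobian_mat N F c = Matrix.mat N N (\<lambda>(i, j). partial_deriv (\<lambda>x. F x (Suc i)) (Suc j) c)"

definition diagonalizable :: "'a::field mat \<Rightarrow> bool" where
  "diagonalizable A \<longleftrightarrow> (\<exists>D. diagonal_mat D \<and> similar_mat A D)"

definition d :: "nat \<Rightarrow> real \<Rightarrow> (nat \<Rightarrow> real) \<Rightarrow> (nat \<Rightarrow> real) \<Rightarrow> (nat \<Rightarrow> real) \<Rightarrow> nat \<Rightarrow> real" where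
  "d N \<epsilon> a b c i = 1 + eta \<epsilon> a i * inverse (1 + (\<Sum>j=1..N. b j * c j))"

text \<open>The partial derivatives exist on the nonnegative orthant, so \<open>deriv\<close> never takes its
  default value there.\<close>

lemma W_partially_differentiable:
  assumes "\<And>k. k \<in> {1..N} \<Longrightarrow> b k > 0" "\<And>k. k \<in> {1..N} \<Longrightarrow> c k \<ge> 0"
  shows "(\<lambda>t. W N \<epsilon> a b (c(j := t)) i) field_differentiable at (c j)"
proof -
  have comp: "(\<lambda>t. (c(j := t)) k) field_differentiable at (c j)" for k
    by (cases "k = j") auto
  have "(\<Sum>k=1..N. b k * c k) \<ge> 0"
    by (intro sum_nonneg mult_nonneg_nonneg) (use assms in \<open>auto intro: less_imp_le\<close>)
  then have "1 + (\<Sum>k=1..N. b k * (c(j := c j)) k) \<noteq> 0"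
    unfolding fun_upd_triv by linarith
  then show ?thesis
    unfolding W_def
    by (intro derivative_intros field_differentiable_mult field_differentiable_add
        field_differentiable_divide field_differentiable_sum field_differentiable_const comp)
qed

end

theory Submission
  imports Defs
begin

text \<open>
  Write \<open>S = 1 + (\<Sum>j. b j * c j)\<close>. Differentiating \<open>W\<close> shows that its Jacobian is
  a diagonal matrix minus a rank-one matrix: its \<open>(i, j)\<close> entry is
  \<open>(if i = j then d i else 0) - u i * b j\<close> with \<open>u i = c i * \<eta> i / S\<^sup>2\<close>.  With \<open>w i = u i * b i\<close>,
  a number \<open>x\<close> different from all \<open>d i\<close> is an eigenvalue of such a matrix exactly when it solves the
  secular equation \<open>(\<Sum>i. w i / (d i - x)) = 1\<close>.

  As all \<open>w i\<close> are positive, clearing denominators in the secular equation gives a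
  polynomial whose signs at \<open>1, d 1, d 2, \<dots>, d N\<close> alternate, so the intermediate value
  theorem puts one root \<open>r k\<close> into each of the \<open>N\<close> gaps (\<open>secular_roots_interlace\<close>). At the
  left end \<open>1\<close> the sign is right because \<open>(\<Sum>i. w i / (d i - 1)) = (S - 1) / S < 1\<close>.

  Diagonalizability comes from explicit eigenvectors. The vectors
  \<open>u i / (d i - r k)\<close> and \<open>b j / (d j - r k)\<close> are right and left eigenvectors
  for \<open>r k\<close>, and partial fractions turn the secular equations of \<open>r k\<close> and \<open>r l\<close> into
  their orthogonality for \<open>k \<noteq> l\<close> (\<open>secular_orthogonality\<close>). So the suitably scaled left
  eigenvectors form the inverse of the matrix of right eigenvectors
  (\<open>diagonal_minus_rank_one_similar\<close>). The similarity also gives the characteristic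
  polynomial, hence the whole spectrum over the reals and over the complex numbers.
\<close>

section \<open>The secular equation\<close>

text \<open>The secular equation after multiplication by \<open>\<Prod>i<n. \<delta> i - x\<close>. Unlike the
  rational function, this is continuous everywhere, and at a pole \<open>\<delta> i\<close> it
  reduces to a single product.\<close>

definition secular :: "nat \<Rightarrow> (nat \<Rightarrow> real) \<Rightarrow> (nat \<Rightarrow> real) \<Rightarrow> real \<Rightarrow> real" where
  "secular n \<delta> w x =
    (\<Prod>i<n. \<delta> i - x) - (\<Sum>i<n. w i * (\<Prod>j\<in>{..<n} - {i}. \<delta> j - x))"

lemma continuous_on_secular: "continuous_on A (secular n \<delta> w)"
  unfolding secular_def by (intro continuous_intros)

lemma secular_at_non_pole:
  assumes "\<And>i. i < n \<Longrightarrow> \<delta> i \<noteq> x"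
  shows "secular n \<delta> w x = (\<Prod>i<n. \<delta> i - x) * (1 - (\<Sum>i<n. w i / (\<delta> i - x)))"
proof -
  have "w i * (\<Prod>j\<in>{..<n} - {i}. \<delta> j - x) = (\<Prod>j<n. \<delta> j - x) * (w i / (\<delta> i - x))"
    if "i < n" for i
    using that assms[OF that] by (simp add: prod.remove[of "{..<n}" i] field_simps)
  then show ?thesis
    by (simp add: secular_def right_diff_distrib sum_distrib_left)
qed

lemma secular_at_pole:
  assumes "i < n"
  shows "secular n \<delta> w (\<delta> i) = - (w i * (\<Prod>j\<in>{..<n} - {i}. \<delta> j - \<delta> i))"
proof -
  have zero: "(\<Prod>j<n. \<delta> j - \<delta> i) = 0"
    using assms by (intro prod_zero) auto
  have "(\<Prod>j\<in>{..<n} - {k}. \<delta> j - \<delta> i) = 0" if "k \<noteq> i" for k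
    using assms that by (intro prod_zero) auto
  then have "(\<Sum>k<n. w k * (\<Prod>j\<in>{..<n} - {k}. \<delta> j - \<delta> i)) =
      (\<Sum>k<n. if k = i then w i * (\<Prod>j\<in>{..<n} - {i}. \<delta> j - \<delta> i) else 0)"
    by (intro sum.cong) auto
  then show ?thesis
    using assms by (simp add: secular_def zero)
qed

text \<open>In the product of the differences \<open>\<delta> j - \<delta> i\<close>, exactly the \<open>i\<close> factors with
  \<open>j < i\<close> are negative.\<close>

lemma sign_secular_at_pole:
  assumes "strict_mono_on {..<n} \<delta>" "i < n" "w i > 0"
  shows "(-1) ^ i * secular n \<delta> w (\<delta> i) < 0"
proof -
  have "{..<n} - {i} = {..<i} \<union> {i<..<n}"
    using assms(2) by auto
  moreover have "{..<i} \<inter> {i<..<n} = {}"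
    by auto
  ultimately have "(\<Prod>j\<in>{..<n} - {i}. \<delta> j - \<delta> i) =
      (\<Prod>j<i. (-1) * (\<delta> i - \<delta> j)) * (\<Prod>j\<in>{i<..<n}. \<delta> j - \<delta> i)"
    by (simp add: prod.union_disjoint)
  also have "(\<Prod>j<i. (-1) * (\<delta> i - \<delta> j)) = (-1) ^ i * (\<Prod>j<i. \<delta> i - \<delta> j)"
    by (subst prod.distrib) simp
  finally have "(-1) ^ i * (\<Prod>j\<in>{..<n} - {i}. \<delta> j - \<delta> i) =
      (\<Prod>j<i. \<delta> i - \<delta> j) * (\<Prod>j\<in>{i<..<n}. \<delta> j - \<delta> i)"
    by (simp flip: power_mult_distrib add: mult.assoc[symmetric])
  also have "\<dots> > 0"
    using assms by (intro mult_pos_pos prod_pos) (auto simp: strict_mono_on_def)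
  finally have "w i * ((-1) ^ i * (\<Prod>j\<in>{..<n} - {i}. \<delta> j - \<delta> i)) > 0"
    using assms(3) by simp
  then show ?thesis
    by (simp add: secular_at_pole[OF assms(2)] algebra_simps)
qed

lemma root_between_opposite_signs:
  fixes f :: "real \<Rightarrow> real"
  assumes "x < y" "continuous_on {x..y} f" "f x * f y < 0"
  obtains z where "x < z" "z < y" "f z = 0"
proof -
  have "\<exists>z\<ge>x. z \<le> y \<and> f z = 0"
    using assms IVT'[of f x 0 y] IVT2'[of f y 0 x] by (auto simp: mult_less_0_iff)
  then obtain z where z: "x \<le> z" "z \<le> y" "f z = 0"
    by blast
  moreover have "z \<noteq> x" "z \<noteq> y"
    using z(3) assms(3) by auto
  ultimately show thesis
    using that by force
qed

text \<open>The bound at \<open>\<mu>\<close> makes \<open>secular\<close> positive there, which extends to the left the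
  alternation of signs at the poles; so \<open>\<mu>\<close> serves as the left end of the first gap.\<close>

lemma secular_roots_interlace:
  assumes mono: "strict_mono_on {..<n} \<delta>"
    and w: "\<And>i. i < n \<Longrightarrow> w i > 0"
    and mu: "\<And>i. i < n \<Longrightarrow> \<mu> < \<delta> i" "(\<Sum>i<n. w i / (\<delta> i - \<mu>)) < 1"
  obtains r where
    "\<And>k. k < n \<Longrightarrow> secular n \<delta> w (r k) = 0"
    "\<And>k. k < n \<Longrightarrow> \<mu> < r k"
    "\<And>k. k < n \<Longrightarrow> r k < \<delta> k"
    "\<And>k. Suc k < n \<Longrightarrow> \<delta> k < r (Suc k)"
proof -
  let ?e = "\<lambda>k. case k of 0 \<Rightarrow> \<mu> | Suc i \<Rightarrow> \<delta> i"
  have left: "(-1) ^ k * secular n \<delta> w (?e k) > 0" if "k < n" for k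
  proof (cases k)
    case 0
    have "secular n \<delta> w \<mu> = (\<Prod>i<n. \<delta> i - \<mu>) * (1 - (\<Sum>i<n. w i / (\<delta> i - \<mu>)))"
      using mu(1) by (intro secular_at_non_pole) force
    then show ?thesis
      using 0 mu by (auto intro!: mult_pos_pos prod_pos)
  next
    case (Suc i)
    then show ?thesis
      using sign_secular_at_pole[of n \<delta> i w] mono w that by simp
  qed
  have "\<exists>z. ?e k < z \<and> z < \<delta> k \<and> secular n \<delta> w z = 0" if "k < n" for k
  proof -
    have "?e k < \<delta> k"
      using mu(1) mono that by (auto split: nat.split simp: strict_mono_on_def)
    moreover have "((-1) ^ k * secular n \<delta> w (?e k)) * ((-1) ^ k * secular n \<delta> w (\<delta> k)) < 0"
      using left[OF that] sign_secular_at_pole[of n \<delta> k w, OF mono that w[OF that]] by (rule mult_pos_neg)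
    then have "secular n \<delta> w (?e k) * secular n \<delta> w (\<delta> k) < 0"
      by (cases "even k") simp_all
    ultimately show ?thesis
      using root_between_opposite_signs[OF _ continuous_on_secular] by metis
  qed
  then obtain r where l: "\<And>k. k < n \<Longrightarrow> ?e k < r k \<and> r k < \<delta> k \<and> secular n \<delta> w (r k) = 0"
    by metis
  have "\<mu> < r k" if "k < n" for k
    using l[OF that] that mu(1)[of "k - 1"] by (cases k) auto
  moreover have "\<delta> k < r (Suc k)" if "Suc k < n" for k
    using l[OF that] by simp
  ultimately show thesis
    using l that by blast
qed

text \<open>Partial fractions: \<open>1 / ((\<delta> - x) * (\<delta> - y))\<close> is a multiple of the difference of
  \<open>1 / (\<delta> - x)\<close> and \<open>1 / (\<delta> - y)\<close>, whose weighted sums are both 1.\<close>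

lemma secular_orthogonality:
  fixes \<delta> w :: "nat \<Rightarrow> 'a::field"
  assumes "x \<noteq> y" "\<And>i. i < n \<Longrightarrow> \<delta> i \<noteq> x" "\<And>i. i < n \<Longrightarrow> \<delta> i \<noteq> y"
    and "(\<Sum>i<n. w i / (\<delta> i - x)) = 1" "(\<Sum>i<n. w i / (\<delta> i - y)) = 1"
  shows "(\<Sum>i<n. w i / ((\<delta> i - x) * (\<delta> i - y))) = 0"
proof -
  have "w i / ((\<delta> i - x) * (\<delta> i - y)) = (w i / (\<delta> i - x) - w i / (\<delta> i - y)) / (x - y)"
    if "i < n" for i
  proof -
    have "\<delta> i - x \<noteq> 0" "\<delta> i - y \<noteq> 0" "x - y \<noteq> 0"
      using assms(1) assms(2,3)[OF that] by auto
    then show ?thesis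
      by (simp add: divide_simps) (simp add: algebra_simps)
  qed
  then have "(\<Sum>i<n. w i / ((\<delta> i - x) * (\<delta> i - y))) =
      ((\<Sum>i<n. w i / (\<delta> i - x)) - (\<Sum>i<n. w i / (\<delta> i - y))) / (x - y)"
    by (simp add: sum_subtractf flip: sum_divide_distrib)
  then show ?thesis
    by (simp add: assms)
qed

section \<open>Diagonal matrices perturbed by a matrix of rank one\<close>

text \<open>Column \<open>k\<close> of \<open>P\<close> is a right eigenvector and row \<open>k\<close> of \<open>Q\<close> a left one, divided
  by \<open>m k\<close> so that the two have product 1. The positivity of the \<open>u i * v i\<close> makes \<open>m k\<close>
  nonzero.\<close>

lemma diagonal_minus_rank_one_similar:
  fixes \<delta> u v r :: "nat \<Rightarrow> real"
  assumes pos: "\<And>i. i < n \<Longrightarrow> u i * v i > 0"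
    and inj: "inj_on r {..<n}"
    and np: "\<And>i k. i < n \<Longrightarrow> k < n \<Longrightarrow> \<delta> i \<noteq> r k"
    and sec: "\<And>k. k < n \<Longrightarrow> (\<Sum>i<n. u i * v i / (\<delta> i - r k)) = 1"
  shows "similar_mat (mat n n (\<lambda>(i, j). (if i = j then \<delta> i else 0) - u i * v j))
    (mat n n (\<lambda>(i, j). if i = j then r i else 0))"
    (is "similar_mat ?A ?D")
proof -
  define m where "m k = (\<Sum>i<n. u i * v i / ((\<delta> i - r k) * (\<delta> i - r k)))" for k
  define P where "P = mat n n (\<lambda>(i, k). u i / (\<delta> i - r k))"
  define Q where "Q = mat n n (\<lambda>(k, j). v j / (\<delta> j - r k) / m k)"
  have dims: "?A \<in> carrier_mat n n" "?D \<in> carrier_mat n n" "P \<in> carrier_mat n n"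
      "Q \<in> carrier_mat n n"
    by (auto simp: P_def Q_def)
  have m: "m k > 0" if "k < n" for k
  proof -
    have "u i * v i / ((\<delta> i - r k) * (\<delta> i - r k)) > 0" if "i < n" for i
      using pos[OF that] np[OF that \<open>k < n\<close>]
      by (intro divide_pos_pos) (auto simp: zero_less_mult_iff)
    then show ?thesis
      unfolding m_def using that by (intro sum_pos) auto
  qed
  have "Q * P = 1\<^sub>m n"
  proof (rule eq_matI)
    fix k l assume kl: "k < dim_row (1\<^sub>m n :: real mat)" "l < dim_col (1\<^sub>m n :: real mat)"
    have "(Q * P) $$ (k, l) =
        (\<Sum>i<n. u i * v i / ((\<delta> i - r k) * (\<delta> i - r l))) / m k"
      using kl by (simp add: P_def Q_def scalar_prod_def sum_divide_distrib
          lessThan_atLeast0 mult_ac)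
    also have "\<dots> = 1\<^sub>m n $$ (k, l)"
    proof (cases "k = l")
      case True
      then show ?thesis
        using kl m[of k] by (simp add: m_def)
    next
      case False
      then have "r k \<noteq> r l"
        using inj kl by (auto dest: inj_onD)
      then have "(\<Sum>i<n. u i * v i / ((\<delta> i - r k) * (\<delta> i - r l))) = 0"
        using kl np sec by (intro secular_orthogonality) auto
      then show ?thesis
        using False kl by simp
    qed
    finally show "(Q * P) $$ (k, l) = 1\<^sub>m n $$ (k, l)" .
  qed (auto simp: P_def Q_def)
  moreover from this have PQ: "P * Q = 1\<^sub>m n"
    using mat_mult_left_right_inverse[OF dims(4,3)] by simp
  moreover have "?A = P * ?D * Q"
  proof -
    have "?A * P = P * ?D"
    proof (rule eq_matI)
      fix i k assume "i < dim_row (P * ?D)" "k < dim_col (P * ?D)"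
      then have ik: "i < n" "k < n"
        by (auto simp: P_def)
      have "(?A * P) $$ (i, k) =
          (\<Sum>j<n. ((if i = j then \<delta> i else 0) - u i * v j) * (u j / (\<delta> j - r k)))"
        using ik by (simp add: P_def scalar_prod_def lessThan_atLeast0)
      also have "\<dots> = (\<Sum>j<n. (if i = j then \<delta> i * (u i / (\<delta> i - r k)) else 0) -
          u i * (u j * v j / (\<delta> j - r k)))"
        by (intro sum.cong) (auto simp: algebra_simps)
      also have "\<dots> = \<delta> i * (u i / (\<delta> i - r k)) -
          u i * (\<Sum>j<n. u j * v j / (\<delta> j - r k))"
        unfolding sum_subtractf sum_distrib_left using ik by simp
      also have "\<dots> = \<delta> i * (u i / (\<delta> i - r k)) - u i"
        using sec[OF ik(2)] by simp
      also have "\<dots> = u i / (\<delta> i - r k) * r k"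
        using np[OF ik] by (simp add: field_simps)
      also have "\<dots> = (\<Sum>j<n. if j = k then u i / (\<delta> i - r k) * r k else 0)"
        using ik by simp
      also have "\<dots> = (\<Sum>j<n. u i / (\<delta> i - r j) * (if j = k then r j else 0))"
        by (intro sum.cong) auto
      also have "\<dots> = (P * ?D) $$ (i, k)"
        using ik by (simp add: P_def scalar_prod_def lessThan_atLeast0)
      finally show "(?A * P) $$ (i, k) = (P * ?D) $$ (i, k)" .
    qed (auto simp: P_def)
    then have "P * ?D * Q = ?A * (P * Q)"
      using assoc_mult_mat[OF dims(1,3,4)] by simp
    then show ?thesis
      using right_mult_one_mat[OF dims(1)] by (simp add: PQ)
  qed
  ultimately have "similar_mat_wit ?A ?D P Q"
    using dims by (intro similar_mat_witI)
  then show ?thesis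
    unfolding similar_mat_def by blast
qed

lemma char_poly_similar_diagonal:
  fixes A :: "'a::field mat"
  assumes "similar_mat A (mat n n (\<lambda>(i, j). if i = j then r i else 0))"
  shows "char_poly A = (\<Prod>k<n. [:- r k, 1:])"
proof -
  let ?D = "mat n n (\<lambda>(i, j). if i = j then r i else 0)"
  have "char_poly A = char_poly ?D"
    using assms by (rule char_poly_similar)
  also have "\<dots> = (\<Prod>x\<leftarrow>diag_mat ?D. [:- x, 1:])"
    by (rule char_poly_upper_triangular[of _ n]) auto
  also have "\<dots> = (\<Prod>k<n. [:- r k, 1:])"
    by (simp add: diag_mat_def comp_def prod.list_conv_set_nth lessThan_atLeast0)
  finally show ?thesis .
qed

lemma eigenvalues_of_split_char_poly:
  fixes A :: "'a::field mat"
  assumes "A \<in> carrier_mat n n" "char_poly A = (\<Prod>k<n. [:- r k, 1:])"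
  shows "{z. eigenvalue A z} = r ` {..<n}"
  using assms by (auto simp: eigenvalue_root_char_poly[OF assms(1)] poly_prod)

text \<open>The characteristic polynomial commutes with the embedding of the reals, so a real
  factorization into linear factors leaves no room for nonreal eigenvalues.\<close>

lemma complex_eigenvalues_of_split_char_poly:
  fixes A :: "real mat"
  assumes "A \<in> carrier_mat n n" "char_poly A = (\<Prod>k<n. [:- r k, 1:])"
  shows "{z. eigenvalue (map_mat complex_of_real A) z} = complex_of_real ` r ` {..<n}"
proof -
  interpret map_poly_comm_ring_hom complex_of_real ..
  have "char_poly (map_mat complex_of_real A) = (\<Prod>k<n. [:- complex_of_real (r k), 1:])"
    using assms by (simp add: of_real_hom.char_poly_hom hom_prod)
  from eigenvalues_of_split_char_poly[OF _ this] assms(1) show ?thesis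
    by (simp add: image_image)
qed

section \<open>The Jacobian matrix\<close>

lemma partial_deriv_W:
  assumes "j \<in> {1..N}" "1 + (\<Sum>k=1..N. b k * c k) \<noteq> 0"
  shows "partial_deriv (\<lambda>x. W N \<epsilon> a b x i) j c = (if i = j then d N \<epsilon> a b c i else 0) -
    c i * eta \<epsilon> a i / (1 + (\<Sum>k=1..N. b k * c k))\<^sup>2 * b j"
proof -
  let ?S = "1 + (\<Sum>k=1..N. b k * c k)"
  define R where "R = (\<Sum>k\<in>{1..N} - {j}. b k * c k)"
  have sum_upd: "(\<Sum>k=1..N. b k * (c(j := t)) k) = b j * t + R" for t
    using assms(1) by (subst sum.remove[of _ j]) (auto simp: R_def)
  have S: "?S = 1 + (b j * c j + R)"
    using sum_upd[of "c j"] by simp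
  have upd: "((\<lambda>t. (c(j := t)) i) has_field_derivative (if i = j then 1 else 0)) (at (c j))"
    by (cases "i = j") auto
  have "((\<lambda>t. 1 + eta \<epsilon> a i / (1 + (b j * t + R))) has_field_derivative
      - (eta \<epsilon> a i * b j) / ?S\<^sup>2) (at (c j))"
    using assms(2) unfolding S
    by (auto intro!: derivative_eq_intros simp: power2_eq_square)
  from DERIV_mult[OF upd this]
  have "((\<lambda>t. W N \<epsilon> a b (c(j := t)) i) has_field_derivative
      (if i = j then d N \<epsilon> a b c i else 0) - c i * eta \<epsilon> a i / ?S\<^sup>2 * b j) (at (c j))"
    unfolding W_def sum_upd d_def S
    by (rule DERIV_cong) (simp add: divide_inverse)
  then show ?thesis
    unfolding partial_deriv_def by (rule DERIV_imp_deriv)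
qed

lemma jacobian_W:
  assumes "1 + (\<Sum>k=1..N. b k * c k) \<noteq> 0"
  shows "jacobian_mat N (W N \<epsilon> a b) c = mat N N (\<lambda>(i, j).
    (if i = j then d N \<epsilon> a b c (Suc i) else 0) -
    c (Suc i) * eta \<epsilon> a (Suc i) / (1 + (\<Sum>k=1..N. b k * c k))\<^sup>2 * b (Suc j))"
  unfolding jacobian_mat_def
  by (rule eq_matI) (auto simp: partial_deriv_W[OF _ assms])

theorem theorem2p1:
  fixes N :: nat and \<epsilon> :: real and a b c :: "nat \<Rightarrow> real"
  assumes "N \<ge> 1"
    and "0 < \<epsilon>" and "\<epsilon> < 1"
    and "\<forall>i\<in>{1..N}. a i > 0"
    and "\<forall>i\<in>{1..N}. b i > 0"
    and "strict_mono_on {1..N} a"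
    and "\<forall>i\<in>{1..N}. c i > 0"
  defines "J \<equiv> jacobian_mat N (W N \<epsilon> a b) c"
  shows "diagonalizable J \<and>
    (\<exists>ev :: nat \<Rightarrow> real.
      {z :: complex. eigenvalue (map_mat complex_of_real J) z} = complex_of_real ` ev ` {1..N} \<and>
      {x :: real. eigenvalue J x} = ev ` {1..N} \<and>
      (\<forall>i\<in>{1..N}. ev i > 0) \<and>
      inj_on ev {1..N} \<and>
      1 < ev 1 \<and>
      (\<forall>i\<in>{1..N}. ev i < d N \<epsilon> a b c i) \<and>
      (\<forall>i\<in>{1..<N}. d N \<epsilon> a b c i < ev (Suc i)))"
proof -
  define S where "S = 1 + (\<Sum>k=1..N. b k * c k)"
  define \<delta> where "\<delta> i = d N \<epsilon> a b c (Suc i)" for i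
  define u where "u i = c (Suc i) * eta \<epsilon> a (Suc i) / S\<^sup>2" for i
  define v where "v i = b (Suc i)" for i
  have "(\<Sum>k=1..N. b k * c k) \<ge> 0"
    using assms(5,7) by (intro sum_nonneg) (simp add: less_imp_le)
  then have S: "S > 0"
    by (simp add: S_def)
  have eta: "eta \<epsilon> a i > 0" if "i \<in> {1..N}" for i
    using assms(2-4) that by (simp add: eta_def)
  have J: "J = mat N N (\<lambda>(i, j). (if i = j then \<delta> i else 0) - u i * v j)"
    using S unfolding J_def \<delta>_def u_def v_def S_def by (subst jacobian_W) simp_all
  then have J_carrier: "J \<in> carrier_mat N N"
    by simp
  have \<delta>: "\<delta> i = 1 + eta \<epsilon> a (Suc i) / S" for i
    by (simp add: \<delta>_def d_def S_def divide_inverse)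
  have pos: "u i * v i > 0" if "i < N" for i
    using that S eta[of "Suc i"] assms(5,7) by (simp add: u_def v_def)
  have mono: "strict_mono_on {..<N} \<delta>"
  proof (rule strict_mono_onI)
    fix i j assume "i \<in> {..<N}" "j \<in> {..<N}" "i < j"
    then have "a (Suc i) < a (Suc j)"
      using assms(6) by (auto simp: strict_mono_on_def)
    then have "eta \<epsilon> a (Suc i) < eta \<epsilon> a (Suc j)"
      unfolding eta_def using assms(2,3) by (intro mult_strict_left_mono) auto
    then show "\<delta> i < \<delta> j"
      using S by (simp add: \<delta> divide_strict_right_mono)
  qed
  have gt1: "1 < \<delta> i" if "i < N" for i
    using that S eta[of "Suc i"] by (simp add: \<delta>)
  have "(\<Sum>i<N. u i * v i / (\<delta> i - 1)) = (\<Sum>i<N. b (Suc i) * c (Suc i) / S)"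
  proof (rule sum.cong)
    fix i assume "i \<in> {..<N}"
    then show "u i * v i / (\<delta> i - 1) = b (Suc i) * c (Suc i) / S"
      using S eta[of "Suc i"] by (simp add: \<delta> u_def v_def field_simps power2_eq_square)
  qed simp
  also have "\<dots> = (\<Sum>k=1..N. b k * c k) / S"
    by (simp add: sum.atLeast1_atMost_eq sum_divide_distrib)
  also have "\<dots> < 1"
    using S by (simp add: S_def)
  finally have bound1: "(\<Sum>i<N. u i * v i / (\<delta> i - 1)) < 1" .
  obtain r where root: "\<And>k. k < N \<Longrightarrow> secular N \<delta> (\<lambda>i. u i * v i) (r k) = 0"
    and lower: "\<And>k. k < N \<Longrightarrow> 1 < r k"
    and upper: "\<And>k. k < N \<Longrightarrow> r k < \<delta> k"
    and gap: "\<And>k. Suc k < N \<Longrightarrow> \<delta> k < r (Suc k)"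
    using secular_roots_interlace[of N \<delta> "\<lambda>i. u i * v i" 1, OF mono pos gt1 bound1] by blast
  have left: "\<delta> i < r k" if "i < k" "k < N" for i k
  proof -
    obtain l where l: "k = Suc l"
      using \<open>i < k\<close> by (cases k) auto
    then have "\<delta> i \<le> \<delta> l"
      using strict_mono_onD[OF mono, of i l] that by (cases "i = l") auto
    also have "\<delta> l < r k"
      using gap l that by simp
    finally show ?thesis .
  qed
  have right: "r k < \<delta> i" if "k \<le> i" "i < N" for i k
    using upper[of k] strict_mono_onD[OF mono, of k i] that by (cases "i = k") auto
  have np: "\<delta> i \<noteq> r k" if "i < N" "k < N" for i k
    using left[of i k] right[of k i] that by (cases "i < k") auto
  have "r k < r l" if "k < l" "l < N" for k l
    using right[of k k] left[OF that] that by simp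
  then have inj: "inj_on r {..<N}"
    by (intro strict_mono_on_imp_inj_on strict_mono_onI) auto
  have sec: "(\<Sum>i<N. u i * v i / (\<delta> i - r k)) = 1" if "k < N" for k
    using root[OF that] np that by (simp add: secular_at_non_pole)
  let ?D = "mat N N (\<lambda>(i, j). if i = j then r i else 0)"
  have sim: "similar_mat J ?D"
    unfolding J by (rule diagonal_minus_rank_one_similar[OF pos inj np sec])
  moreover have "diagonal_mat ?D"
    by (simp add: diagonal_mat_def)
  ultimately have "diagonalizable J"
    unfolding diagonalizable_def by blast
  moreover
  note cp = char_poly_similar_diagonal[OF sim]
  define ev where "ev i = r (i - 1)" for i
  have ev_image: "ev ` {1..N} = r ` {..<N}"
    by (simp add: ev_def image_image flip: image_Suc_lessThan del: One_nat_def)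
  have "{z. eigenvalue (map_mat complex_of_real J) z} = complex_of_real ` ev ` {1..N}"
    unfolding ev_image by (rule complex_eigenvalues_of_split_char_poly[OF J_carrier cp])
  moreover have "{x. eigenvalue J x} = ev ` {1..N}"
    unfolding ev_image by (rule eigenvalues_of_split_char_poly[OF J_carrier cp])
  moreover have "\<forall>i\<in>{1..N}. ev i > 0"
  proof
    fix i assume "i \<in> {1..N}"
    then have "1 < r (i - 1)"
      by (intro lower) auto
    then show "ev i > 0"
      by (simp add: ev_def)
  qed
  moreover have "inj_on ev {1..N}"
  proof (rule inj_onI)
    fix i j assume ij: "i \<in> {1..N}" "j \<in> {1..N}" "ev i = ev j"
    then have "i - 1 \<in> {..<N}" "j - 1 \<in> {..<N}"
      by auto
    then have "i - 1 = j - 1"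
      using inj ij(3) by (auto simp: ev_def dest: inj_onD)
    then show "i = j"
      using ij by auto
  qed
  moreover have "1 < ev 1"
    using lower assms(1) by (simp add: ev_def)
  moreover have "\<forall>i\<in>{1..N}. ev i < d N \<epsilon> a b c i"
  proof
    fix i assume "i \<in> {1..N}"
    then show "ev i < d N \<epsilon> a b c i"
      using upper[of "i - 1"] by (auto simp: ev_def \<delta>_def)
  qed
  moreover have "\<forall>i\<in>{1..<N}. d N \<epsilon> a b c i < ev (Suc i)"
  proof
    fix i assume "i \<in> {1..<N}"
    then show "d N \<epsilon> a b c i < ev (Suc i)"
      using gap[of "i - 1"] by (simp add: ev_def \<delta>_def)
  qed
  ultimately show ?thesis
    by blast
qed

end
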